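(* Let $X$ be a finite alphabet, let $s \geq 0$ be an integer, and let $K \leq \mathrm{Aut}(X^* )$ be a self-similar group of tree automorphisms of $X^*$. Let $G \leq \mathrm{Aut}(X^* )$ be the finitely constrained group defined by allowing exactly the patterns of size $s+1$ that appear in elements of $K$, i.e. \[ G = \{\, g \in \mathrm{Aut}(X^* ) \mid \text{every pattern of size } s+1 \text{ that } g \text{ contains at any vertex appears in some element of } K \,\}. \] Then there exists a self-similar, countable group $H \leq \mathrm{Aut}(X^* )$ that is a regular branch group, branching over its level $s$ stabilizer $H_s$, such that $G$ is the topological closure of $H$ in $\mathrm{Aut}(X^* )$. Moreover, if $K$ is contracting, then $H$ may be chosen to be contracting as well.
   Context: Let $X=\{0,1,\dots,k-1\}$ be a finite alphabet with $k \ge 1$ letters. $X^*$ denotes both the set of finite words over $X$ and the $k$-ary rooted tree whose vertices are these words, with root the empty word $\emptyset$ and each vertex $u$ joined to its children $ux$, $x\in X$; level $n$ is $X^n$. $\mathrm{Aut}(X^* )$ is the group of rooted tree automorphisms, with product $(fg)(u)=f(g(u))$. For $g \in \mathrm{Aut}(X^* )$ and a vertex $u$, $g_{(u)}\in \mathrm{Sym}(X)$ is the permutation defined by $g(ux)=g(u)\,g_{(u)}(x)$ for $x \in X$. The map $u\mapsto g_{(u)}$ is the portrait of $g$; every map $X^*\to \mathrm{Sym}(X)$ is the portrait of a unique automorphism, so automorphisms are identified with portraits. The section of $g$ at $u$ is the automorphism $g|_u$ with $(g|_u)_{(v)} = g_{(uv)}$ for all $v$. Write $(h_0,\dots,h_{k-1})$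 for the automorphism that fixes level 1 pointwise and has section $h_x$ at each $x\in X$. Topology: $\mathrm{Aut}(X^* )$ carries the metric $d(g,h)=\sup\{2^{-|u|} \mid u\in X^*,\ g_{(u)}\ne h_{(u)}\}$ for $g \neq h$ (equivalently, the product topology on $\mathrm{Sym}(X)^{X^*}$ with $\mathrm{Sym}(X)$ discrete). Patterns: a pattern of size $m\ge 1$ is a map $p:\bigcup_{i=0}^{m-1}X^i\to \mathrm{Sym}(X)$, $v \mapsto p_{(v)}$. An automorphism $g$ contains $p$ at the vertex $u$ if $g_{(uv)}=p_{(v)}$ for all words $v$ with $|v|\le m-1$; $p$ appears in $g$ if $g$ contains $p$ at some vertex. A finitely constrained group is a subgroup of $\mathrm{Aut}(X^* )$ consisting of all automorphisms that contain no pattern from some fixed finite set of forbidden patterns at any vertex. A set (in particular a group) of tree automorphisms is self-similar if it contains all sections of all of its elements. For a group $H\le \mathrm{Aut}(X^* )$, the level $n$ stabilizer $H_n$ is the subgroup of elements of $H$ fixing every vertex of level $n$. The group $H$ is a regular branch group, branching over its level $s$ stabilizer $H_s$, if for all $h_0,\dots,h_{k-1}\in H_s$ the automorphism $(h_0,\dots,h_{k-1})$ is also an element of $H_s$. A self-similar group $K\le \mathrm{Aut}(X^* )$ is contracting if there is a finite set $\mathcal N$ of automorphisms such that for every $g\in K$ there exists $n$ (depending on $g$) such that for all $m\ge n$ all sections of $g$ at vertices of level $m$ belong to $\mathcal N$. "Countable" means at most countable. *)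

theory Defs
  imports "HOL-Analysis.Analysis" "HOL-Algebra.Group"
begin

text \<open>The alphabet is a type \<open>'x\<close> of class \<open>finite\<close> (types are inhabited, so it has at
  least one letter). The vertices of the rooted tree are the words, i.e. all values of type
  \<open>'x list\<close>, with root \<open>[]\<close>; a word of length \<open>n\<close> is a vertex of level \<open>n\<close>.\<close>

definition tree_edge :: "'x list \<Rightarrow> 'x list \<Rightarrow> bool" where
  "tree_edge u v \<longleftrightarrow> (\<exists>x. v = u @ [x] \<or> u = v @ [x])"

definition tree_Aut :: "('x list \<Rightarrow> 'x list) monoid" where
  "tree_Aut =
    \<lparr>carrier = {g. bij g \<and> g [] = [] \<and> (\<forall>u v. tree_edge (g u) (g v) \<longleftrightarrow> tree_edge u v)},
     mult = (\<circ>), one = id\<rparr>"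

definition portrait :: "('x list \<Rightarrow> 'x list) \<Rightarrow> 'x list \<Rightarrow> 'x \<Rightarrow> 'x" where
  "portrait g u = (\<lambda>x. THE y. g (u @ [x]) = g u @ [y])"

definition sect :: "('x list \<Rightarrow> 'x list) \<Rightarrow> 'x list \<Rightarrow> ('x list \<Rightarrow> 'x list)" where
  "sect g u = (THE h. h \<in> carrier tree_Aut \<and> (\<forall>v. portrait h v = portrait g (u @ v)))"

definition level_one :: "('x \<Rightarrow> 'x list \<Rightarrow> 'x list) \<Rightarrow> ('x list \<Rightarrow> 'x list)" where
  "level_one h = (THE g. g \<in> carrier tree_Aut \<and> (\<forall>x. g [x] = [x]) \<and> (\<forall>x. sect g [x] = h x))"

text \<open>Automorphisms are identified with their portraits, so comparing portraits here amounts
  to comparing automorphisms; outside \<open>tree_Aut\<close> it keeps the supremum from being taken over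
  the empty set.\<close>

definition tree_dist :: "('x list \<Rightarrow> 'x list) \<Rightarrow> ('x list \<Rightarrow> 'x list) \<Rightarrow> real" where
  "tree_dist g h =
    (if portrait g = portrait h then 0
     else (SUP u\<in>{u. portrait g u \<noteq> portrait h u}. (1/2) ^ length u))"

definition tree_topology :: "('x list \<Rightarrow> 'x list) topology" where
  "tree_topology = Metric_space.mtopology (carrier tree_Aut) tree_dist"

text \<open>Patterns of size \<open>m\<close> are maps on the words of length less than \<open>m\<close>, taken to be
  \<open>undefined\<close> elsewhere so that each pattern is represented exactly once.\<close>

definition patterns :: "nat \<Rightarrow> ('x list \<Rightarrow> 'x \<Rightarrow> 'x) set" where
  "patterns m = {v. length v < m} \<rightarrow>\<^sub>E {\<pi>. bij \<pi>}"

definition contains_pattern ::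
    "nat \<Rightarrow> ('x list \<Rightarrow> 'x list) \<Rightarrow> ('x list \<Rightarrow> 'x \<Rightarrow> 'x) \<Rightarrow> 'x list \<Rightarrow> bool" where
  "contains_pattern m g p u \<longleftrightarrow> (\<forall>v. length v < m \<longrightarrow> portrait g (u @ v) = p v)"

definition appears_in ::
    "nat \<Rightarrow> ('x list \<Rightarrow> 'x \<Rightarrow> 'x) \<Rightarrow> ('x list \<Rightarrow> 'x list) \<Rightarrow> bool" where
  "appears_in m p g \<longleftrightarrow> (\<exists>u. contains_pattern m g p u)"

definition self_similar :: "('x list \<Rightarrow> 'x list) set \<Rightarrow> bool" where
  "self_similar S \<longleftrightarrow> (\<forall>g\<in>S. \<forall>u. sect g u \<in> S)"

definition level_stabilizer ::
    "('x list \<Rightarrow> 'x list) set \<Rightarrow> nat \<Rightarrow> ('x list \<Rightarrow> 'x list) set" where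
  "level_stabilizer H n = {g \<in> H. \<forall>u. length u = n \<longrightarrow> g u = u}"

definition regular_branch_over_level :: "('x list \<Rightarrow> 'x list) set \<Rightarrow> nat \<Rightarrow> bool" where
  "regular_branch_over_level H s \<longleftrightarrow>
    (\<forall>h. (\<forall>x. h x \<in> level_stabilizer H s) \<longrightarrow> level_one h \<in> level_stabilizer H s)"

definition contracting :: "('x list \<Rightarrow> 'x list) set \<Rightarrow> bool" where
  "contracting S \<longleftrightarrow> (\<exists>N. finite N \<and> N \<subseteq> carrier tree_Aut \<and>
    (\<forall>g\<in>S. \<exists>n. \<forall>m\<ge>n. \<forall>u. length u = m \<longrightarrow> sect g u \<in> N))"

text \<open>The rest of this theory shows that the definite descriptions above denote and that
  \<open>tree_dist\<close> is a metric on the carrier of the group \<open>tree_Aut\<close>.\<close>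

lemma tree_Aut_iff:
  "g \<in> carrier tree_Aut \<longleftrightarrow>
    bij g \<and> g [] = [] \<and> (\<forall>u v. tree_edge (g u) (g v) \<longleftrightarrow> tree_edge u v)"
  by (simp add: tree_Aut_def)

lemma tree_Aut_mult [simp]: "g \<otimes>\<^bsub>tree_Aut\<^esub> h = g \<circ> h"
  and tree_Aut_one [simp]: "\<one>\<^bsub>tree_Aut\<^esub> = id"
  by (simp_all add: tree_Aut_def)

lemma group_tree_Aut: "group tree_Aut"
proof (rule groupI)
  fix g :: "'x list \<Rightarrow> 'x list" assume g: "g \<in> carrier tree_Aut"
  then have b: "bij g" by (simp add: tree_Aut_iff)
  have s: "g (inv_into UNIV g u) = u" for u
    using b by (simp add: bij_is_surj surj_f_inv_f)
  have "inv_into UNIV g \<in> carrier tree_Aut"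
    unfolding tree_Aut_iff
  proof (intro conjI allI)
    show "bij (inv_into UNIV g)" using b by (rule bij_imp_bij_inv)
    show "inv_into UNIV g [] = []"
      using g b by (metis tree_Aut_iff bij_is_inj inv_f_f)
    show "tree_edge (inv_into UNIV g u) (inv_into UNIV g v) \<longleftrightarrow> tree_edge u v" for u v
      using g s by (metis tree_Aut_iff)
  qed
  moreover have "inv_into UNIV g \<circ> g = id" using b by (simp add: bij_is_inj)
  ultimately show "\<exists>h\<in>carrier tree_Aut. h \<otimes>\<^bsub>tree_Aut\<^esub> g = \<one>\<^bsub>tree_Aut\<^esub>" by auto
qed (auto simp: tree_Aut_iff bij_comp comp_assoc)

lemma tree_Aut_child:
  assumes g: "g \<in> carrier tree_Aut"
  shows "\<exists>y. g (u @ [x]) = g u @ [y]"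
proof (induction u arbitrary: x rule: length_induct)
  case (1 u)
  have "tree_edge (g u) (g (u @ [x]))"
    using g by (auto simp: tree_Aut_iff tree_edge_def)
  then obtain y where y: "g (u @ [x]) = g u @ [y] \<or> g u = g (u @ [x]) @ [y]"
    by (auto simp: tree_edge_def)
  moreover have False if eq: "g u = g (u @ [x]) @ [y]"
  proof (cases u rule: rev_cases)
    case Nil
    then show False using eq g by (simp add: tree_Aut_iff)
  next
    case (snoc w z)
    then obtain z' where "g u = g w @ [z']" using 1 by fastforce
    then have "g w = g (u @ [x])" using eq by simp
    then have "w = u @ [x]" using g by (simp add: tree_Aut_iff bij_is_inj inj_eq)
    then show False using snoc by simp
  qed
  ultimately show ?case by blast
qed

lemma tree_Aut_snoc:
  assumes "g \<in> carrier tree_Aut"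
  shows "g (u @ [x]) = g u @ [portrait g u x]"
proof -
  obtain y where "g (u @ [x]) = g u @ [y]" using tree_Aut_child[OF assms] by blast
  then show ?thesis by (simp add: portrait_def)
qed

lemma length_tree_Aut: "g \<in> carrier tree_Aut \<Longrightarrow> length (g u) = length u"
  by (induction u rule: rev_induct) (auto simp: tree_Aut_snoc, simp add: tree_Aut_iff)

lemma bij_portrait:
  fixes g :: "'x::finite list \<Rightarrow> 'x list"
  assumes g: "g \<in> carrier tree_Aut"
  shows "bij (portrait g u)"
proof -
  have "inj (portrait g u)"
  proof (rule injI)
    fix x y assume "portrait g u x = portrait g u y"
    then have "g (u @ [x]) = g (u @ [y])" by (simp add: tree_Aut_snoc[OF g])
    then have "u @ [x] = u @ [y]" using g by (simp add: tree_Aut_iff bij_is_inj inj_eq)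
    then show "x = y" by simp
  qed
  then show ?thesis by (simp add: bij_def finite_UNIV_inj_surj)
qed

lemma portrait_unique:
  assumes "g \<in> carrier tree_Aut" "h \<in> carrier tree_Aut" "\<And>u. portrait g u = portrait h u"
  shows "g = h"
proof
  show "g u = h u" for u
    by (induction u rule: rev_induct) (use assms in \<open>auto simp: tree_Aut_snoc tree_Aut_iff\<close>)
qed

primrec of_portrait :: "'x list \<Rightarrow> ('x list \<Rightarrow> 'x \<Rightarrow> 'x) \<Rightarrow> 'x list" where
  "of_portrait [] p = []"
| "of_portrait (x # v) p = p [] x # of_portrait v (\<lambda>w. p (x # w))"

lemma of_portrait_append:
  "of_portrait (u @ v) p = of_portrait u p @ of_portrait v (\<lambda>w. p (u @ w))"
  by (induction u arbitrary: p) auto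

lemma of_portrait_tree_Aut:
  fixes p :: "'x list \<Rightarrow> 'x \<Rightarrow> 'x"
  assumes "\<And>u. bij (p u)"
  shows "(\<lambda>u. of_portrait u p) \<in> carrier tree_Aut"
proof -
  let ?g = "\<lambda>u. of_portrait u p"
  have "u = v" if "of_portrait u q = of_portrait v q" "\<And>u. bij (q u)" 
    for u v and q :: "'x list \<Rightarrow> 'x \<Rightarrow> 'x"
    using that
  proof (induction u arbitrary: v q)
    case Nil
    then show ?case by (cases v) auto
  next
    case (Cons x u)
    then obtain y w where v: "v = y # w" by (cases v) auto
    then have "x = y" using Cons.prems by (metis bij_is_inj inj_eq list.inject of_portrait.simps(2))
    then show ?case
      using Cons.prems Cons.IH[of "\<lambda>w. q (x # w)" w] v by simp
  qed
  then have inj: "inj ?g" using assms by (meson injI)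
  have "\<exists>u. of_portrait u q = v" if "\<And>u. bij (q u)" 
    for v and q :: "'x list \<Rightarrow> 'x \<Rightarrow> 'x"
    using that
  proof (induction v arbitrary: q)
    case Nil
    have "of_portrait [] q = []" by simp
    then show ?case by blast
  next
    case (Cons y v)
    then obtain x where "q [] x = y" by (metis bij_pointE)
    moreover obtain u where "of_portrait u (\<lambda>w. q (x # w)) = v"
      using Cons.IH[of "\<lambda>w. q (x # w)"] Cons.prems by auto
    ultimately have "of_portrait (x # u) q = y # v" by simp
    then show ?case by blast
  qed
  then have surj: "surj ?g" using assms unfolding surj_def by metis
  have snoc: "?g (u @ [x]) = ?g u @ [p u x]" for u x
    by (simp add: of_portrait_append)
  have child: "(\<exists>y. ?g v = ?g u @ [y]) \<longleftrightarrow> (\<exists>x. v = u @ [x])" for u v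
  proof
    assume "\<exists>y. ?g v = ?g u @ [y]"
    then obtain y where y: "?g v = ?g u @ [y]" by blast
    obtain x where "p u x = y" using assms by (metis bij_pointE)
    then have "?g v = ?g (u @ [x])" using y by (simp add: snoc)
    then show "\<exists>x. v = u @ [x]" using inj by (auto dest: injD)
  qed (auto simp: snoc)
  have "tree_edge (?g u) (?g v) \<longleftrightarrow> tree_edge u v" for u v
    unfolding tree_edge_def ex_disj_distrib child ..
  then show ?thesis using inj surj by (simp add: tree_Aut_iff bij_def)
qed

lemma portrait_of_portrait: "portrait (\<lambda>u. of_portrait u p) = p"
  by (rule ext)+ (simp add: portrait_def of_portrait_append)

lemma portrait_ex1:
  assumes "\<And>u. bij (p u)"
  shows "\<exists>!g. g \<in> carrier tree_Aut \<and> (\<forall>u. portrait g u = p u)"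
proof (rule ex1I)
  show "(\<lambda>u. of_portrait u p) \<in> carrier tree_Aut \<and> (\<forall>u. portrait (\<lambda>u. of_portrait u p) u = p u)"
    using of_portrait_tree_Aut[OF assms] by (simp add: portrait_of_portrait)
next
  fix g assume "g \<in> carrier tree_Aut \<and> (\<forall>u. portrait g u = p u)"
  then show "g = (\<lambda>u. of_portrait u p)"
    using of_portrait_tree_Aut[OF assms] by (intro portrait_unique) (simp_all add: portrait_of_portrait)
qed

lemma
  fixes g :: "'x::finite list \<Rightarrow> 'x list"
  assumes g: "g \<in> carrier tree_Aut"
  shows sect_tree_Aut: "sect g u \<in> carrier tree_Aut"
    and portrait_sect: "portrait (sect g u) v = portrait g (u @ v)"
  using theI'[OF portrait_ex1[of "\<lambda>v. portrait g (u @ v)"]] bij_portrait[OF g]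
  by (auto simp: sect_def)

lemma sect_eqI:
  fixes g :: "'x::finite list \<Rightarrow> 'x list"
  assumes "g \<in> carrier tree_Aut" "h \<in> carrier tree_Aut" "\<And>v. portrait h v = portrait g (u @ v)"
  shows "sect g u = h"
  by (rule portrait_unique) (simp_all add: assms sect_tree_Aut portrait_sect)

lemma tree_Aut_append:
  fixes g :: "'x::finite list \<Rightarrow> 'x list"
  assumes g: "g \<in> carrier tree_Aut"
  shows "g (u @ v) = g u @ sect g u v"
proof (induction v rule: rev_induct)
  case Nil
  have "sect g u [] = []" using sect_tree_Aut[OF g] by (simp add: tree_Aut_iff)
  then show ?case by simp
next
  case (snoc x v)
  then show ?case
    using tree_Aut_snoc[OF g, of "u @ v" x] tree_Aut_snoc[OF sect_tree_Aut[OF g], of u v x]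
    by (simp add: portrait_sect[OF g])
qed

lemma level_one_ex1:
  fixes h :: "'x::finite \<Rightarrow> 'x list \<Rightarrow> 'x list"
  assumes h: "\<And>x. h x \<in> carrier tree_Aut"
  shows "\<exists>!g. g \<in> carrier tree_Aut \<and> (\<forall>x. g [x] = [x]) \<and> (\<forall>x. sect g [x] = h x)"
proof -
  define p where "p u = (case u of [] \<Rightarrow> id | x # v \<Rightarrow> portrait (h x) v)" for u
  define g where "g = (\<lambda>u. of_portrait u p)"
  have "bij (p u)" for u using bij_portrait[OF h] by (cases u) (auto simp: p_def)
  then have g: "g \<in> carrier tree_Aut" unfolding g_def by (rule of_portrait_tree_Aut)
  have pg: "portrait g = p" by (simp add: g_def portrait_of_portrait)
  show ?thesis
  proof (intro ex1I conjI allI)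
    show "g \<in> carrier tree_Aut" by (rule g)
    show "g [x] = [x]" for x by (simp add: g_def p_def)
    show "sect g [x] = h x" for x
      by (rule sect_eqI[OF g h]) (simp add: pg p_def)
  next
    fix f assume f: "f \<in> carrier tree_Aut \<and> (\<forall>x. f [x] = [x]) \<and> (\<forall>x. sect f [x] = h x)"
    then have [simp]: "f [] = []" by (simp add: tree_Aut_iff)
    show "f = g"
    proof (rule portrait_unique)
      show "portrait f u = portrait g u" for u
      proof (cases u)
        case Nil
        have "portrait f [] x = x" for x using f tree_Aut_snoc[of f "[]" x] by simp
        then show ?thesis using Nil by (auto simp: pg p_def)
      next
        case (Cons x v)
        then show ?thesis using f portrait_sect[of f "[x]" v] by (simp add: pg p_def)
      qed
    qed (use f g in auto)
  qed
qed

lemma level_one: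
  fixes h :: "'x::finite \<Rightarrow> 'x list \<Rightarrow> 'x list"
  assumes "\<And>x. h x \<in> carrier tree_Aut"
  shows "level_one h \<in> carrier tree_Aut" "level_one h [x] = [x]" "sect (level_one h) [x] = h x"
  using theI'[OF level_one_ex1[OF assms]] by (auto simp: level_one_def)

lemma tree_dist_upper:
  assumes "portrait g u \<noteq> portrait h u"
  shows "(1/2) ^ length u \<le> tree_dist g h"
proof -
  have "bdd_above ((\<lambda>u. (1/2::real) ^ length u) ` {u. portrait g u \<noteq> portrait h u})"
    by (rule bdd_aboveI2[where M = 1]) (simp add: power_le_one)
  moreover have "portrait g \<noteq> portrait h" using assms by auto
  ultimately show ?thesis using assms by (auto simp: tree_dist_def intro!: cSUP_upper)
qed

lemma tree_dist_pos:
  assumes "g \<in> carrier tree_Aut" "h \<in> carrier tree_Aut" "g \<noteq> h"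
  shows "tree_dist g h > 0"
proof -
  obtain u where "portrait g u \<noteq> portrait h u" using portrait_unique assms by blast
  from tree_dist_upper[OF this] show ?thesis
    by (rule less_le_trans[rotated]) simp
qed

lemma Metric_space_tree_Aut: "Metric_space (carrier tree_Aut) tree_dist"
proof
  show nonneg: "0 \<le> tree_dist g h" for g h :: "'x list \<Rightarrow> 'x list"
  proof (cases "portrait g = portrait h")
    case True
    then show ?thesis by (simp add: tree_dist_def)
  next
    case False
    then obtain u where "portrait g u \<noteq> portrait h u" by blast
    from tree_dist_upper[OF this] show ?thesis by (rule order_trans[rotated]) simp
  qed
  show "tree_dist g h = tree_dist h g" for g h :: "'x list \<Rightarrow> 'x list"
  proof -
    have "{u. portrait g u \<noteq> portrait h u} = {u. portrait h u \<noteq> portrait g u}" by auto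
    then show ?thesis by (auto simp: tree_dist_def)
  qed
  show "tree_dist g h = 0 \<longleftrightarrow> g = h" if "g \<in> carrier tree_Aut" "h \<in> carrier tree_Aut"
    for g h :: "'x list \<Rightarrow> 'x list"
    using tree_dist_pos[OF that] by (cases "g = h") (simp_all add: tree_dist_def)
  show "tree_dist f h \<le> tree_dist f g + tree_dist g h"
    for f g h :: "'x list \<Rightarrow> 'x list"
  proof (cases "portrait f = portrait h")
    case True
    then have "tree_dist f h = 0" by (simp add: tree_dist_def)
    then show ?thesis using nonneg[of f g] nonneg[of g h] by linarith
  next
    case False
    have "(SUP u\<in>{u. portrait f u \<noteq> portrait h u}. (1/2) ^ length u)
        \<le> tree_dist f g + tree_dist g h"
    proof (rule cSUP_least)
      show "{u. portrait f u \<noteq> portrait h u} \<noteq> {}" using False by blast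
    next
      fix u assume "u \<in> {u. portrait f u \<noteq> portrait h u}"
      then have "portrait f u \<noteq> portrait g u \<or> portrait g u \<noteq> portrait h u" by auto
      then show "(1/2) ^ length u \<le> tree_dist f g + tree_dist g h"
        using tree_dist_upper[of f u g] tree_dist_upper[of g u h] nonneg[of f g] nonneg[of g h]
        by linarith
    qed
    then show ?thesis using False by (simp add: tree_dist_def)
  qed
qed

end

theory Submission
  imports Defs "HOL-Algebra.Generated_Groups"
begin

text \<open>Finitely many elements of \<open>K\<close> realise all patterns of size \<open>s + 1\<close> that appear in \<open>K\<close>;
  together with all their sections they generate a countable self-similar subgroup \<open>L\<close> of \<open>K\<close> with
  the same patterns. Let \<open>H\<close> consist of the elements of \<open>G\<close> all of whose sections at some level lie
  in \<open>L\<close>. Since \<open>L\<close> is self-similar, that level may be increased at will, so \<open>H\<close> is a group. For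
  density, keep the portrait of \<open>g \<in> G\<close> above level \<open>n\<close> and plug in, at each vertex of level \<open>n\<close>,
  an element of \<open>L\<close> starting with the pattern that \<open>g\<close> has there. The patterns of the resulting
  automorphism at vertices up to level \<open>n\<close> are those of \<open>g\<close>, and all others are patterns of
  \<open>L\<close>. If \<open>K\<close> is contracting, its nucleus also works for \<open>H\<close>.\<close>

interpretation tree: group tree_Aut
  by (rule group_tree_Aut)

section \<open>Sections\<close>

lemma tree_Aut_comp:
  "g \<in> carrier tree_Aut \<Longrightarrow> h \<in> carrier tree_Aut \<Longrightarrow> g \<circ> h \<in> carrier tree_Aut"
  using tree.m_closed[of g h] by simp

lemma id_tree_Aut: "id \<in> carrier tree_Aut"
  using tree.one_closed by simp

lemma tree_Aut_inv_apply:
  assumes "g \<in> carrier tree_Aut"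
  shows "g ((inv\<^bsub>tree_Aut\<^esub> g) v) = v" "(inv\<^bsub>tree_Aut\<^esub> g) (g v) = v"
  using tree.r_inv[OF assms] tree.l_inv[OF assms] by (simp_all add: fun_eq_iff)

text \<open>The tail that \<open>g\<close> appends to \<open>g u\<close> is unique by cancellation,
  so a section can be identified from the action on words, without computing portraits.\<close>

lemma sect_eqI_apply:
  fixes g :: "'x::finite list \<Rightarrow> 'x list"
  assumes "g \<in> carrier tree_Aut" "\<And>v. g (u @ v) = g u @ h v"
  shows "sect g u = h"
  using assms by (simp add: fun_eq_iff tree_Aut_append)

lemma sect_Nil:
  fixes g :: "'x::finite list \<Rightarrow> 'x list"
  assumes "g \<in> carrier tree_Aut"
  shows "sect g [] = g"
  by (rule sect_eqI_apply) (use assms in \<open>simp_all add: tree_Aut_iff\<close>)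

lemma sect_id: "sect id u = (id :: 'x::finite list \<Rightarrow> 'x list)"
  by (rule sect_eqI_apply) (simp_all add: id_tree_Aut)

lemma sect_sect:
  fixes g :: "'x::finite list \<Rightarrow> 'x list"
  assumes g: "g \<in> carrier tree_Aut"
  shows "sect (sect g u) v = sect g (u @ v)"
  by (rule portrait_unique) (simp_all add: g sect_tree_Aut portrait_sect)

lemma sect_comp:
  fixes g h :: "'x::finite list \<Rightarrow> 'x list"
  assumes "g \<in> carrier tree_Aut" "h \<in> carrier tree_Aut"
  shows "sect (g \<circ> h) u = sect g (h u) \<circ> sect h u"
  by (rule sect_eqI_apply) (simp_all add: assms tree_Aut_comp tree_Aut_append)

text \<open>Taking sections of \<open>g\<close> composed with its inverse, which is
  \<open>id\<close>, shows that the section of the inverse at \<open>u\<close> is inverse to the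
  section of \<open>g\<close> at the preimage of \<open>u\<close>.\<close>

lemma sect_inv:
  fixes g :: "'x::finite list \<Rightarrow> 'x list"
  assumes g: "g \<in> carrier tree_Aut"
  shows "sect (inv\<^bsub>tree_Aut\<^esub> g) u = inv\<^bsub>tree_Aut\<^esub> (sect g ((inv\<^bsub>tree_Aut\<^esub> g) u))"
proof -
  define f where "f = inv\<^bsub>tree_Aut\<^esub> g"
  have f: "f \<in> carrier tree_Aut" using g by (simp add: f_def)
  have "g \<circ> f = id" using tree.r_inv[OF g] by (simp add: f_def)
  then have "sect g (f u) \<circ> sect f u = id" using sect_comp[OF g f] by (simp add: sect_id)
  then have "inv\<^bsub>tree_Aut\<^esub> (sect f u) = sect g (f u)"
    using tree.inv_equality[of "sect g (f u)" "sect f u"] f g by (simp add: sect_tree_Aut)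
  then show ?thesis
    using tree.inv_inv[OF sect_tree_Aut[OF f]] by (metis f_def)
qed

lemma finite_words_of_length: "finite {u :: 'x::finite list. length u = n}"
  using finite_lists_length_eq[of "UNIV :: 'x set" n] by simp

lemma finite_words_shorter: "finite {u :: 'x::finite list. length u < n}"
  by (rule finite_subset[OF _ finite_lists_length_le[of "UNIV :: 'x set" n]]) auto

section \<open>Agreement up to a level\<close>

text \<open>For automorphisms this means that the patterns of size \<open>n\<close> at the root
  coincide, because images of words of length \<open>n\<close> are governed by the portrait at
  levels below \<open>n\<close>. One relation thus serves both for patterns and for the
  topology.\<close>

definition agree_upto :: "nat \<Rightarrow> ('x list \<Rightarrow> 'x list) \<Rightarrow> ('x list \<Rightarrow> 'x list) \<Rightarrow> bool" where
  "agree_upto n g h \<longleftrightarrow> (\<forall>v. length v \<le> n \<longrightarrow> g v = h v)"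

lemma agree_upto_trans: "agree_upto n f g \<Longrightarrow> agree_upto n g h \<Longrightarrow> agree_upto n f h"
  by (simp add: agree_upto_def)

lemma agree_upto_iff_portrait:
  assumes g: "g \<in> carrier tree_Aut" and h: "h \<in> carrier tree_Aut"
  shows "agree_upto n g h \<longleftrightarrow> (\<forall>v. length v < n \<longrightarrow> portrait g v = portrait h v)"
proof
  assume a: "agree_upto n g h"
  show "\<forall>v. length v < n \<longrightarrow> portrait g v = portrait h v"
  proof (intro allI impI ext)
    fix v :: "'a list" and x assume "length v < n"
    then have "g v = h v" "g (v @ [x]) = h (v @ [x])" using a by (simp_all add: agree_upto_def)
    then show "portrait g v x = portrait h v x" by (simp add: tree_Aut_snoc g h)
  qed
next
  assume p: "\<forall>v. length v < n \<longrightarrow> portrait g v = portrait h v"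
  have "g v = h v" if "length v \<le> n" for v
    using that
  proof (induction v rule: rev_induct)
    case Nil
    then show ?case using g h by (simp add: tree_Aut_iff)
  next
    case (snoc x v)
    then show ?case using p by (simp add: tree_Aut_snoc g h)
  qed
  then show "agree_upto n g h" by (simp add: agree_upto_def)
qed

lemma agree_upto_comp:
  assumes "agree_upto n g g'" "agree_upto n h h'" "h \<in> carrier tree_Aut"
  shows "agree_upto n (g \<circ> h) (g' \<circ> h')"
  using assms by (simp add: agree_upto_def) (metis length_tree_Aut)

lemma agree_upto_inv:
  assumes a: "agree_upto n g h" and g: "g \<in> carrier tree_Aut" and h: "h \<in> carrier tree_Aut"
  shows "agree_upto n (inv\<^bsub>tree_Aut\<^esub> g) (inv\<^bsub>tree_Aut\<^esub> h)"
  unfolding agree_upto_def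
proof (intro allI impI)
  fix v :: "'a list" assume "length v \<le> n"
  then have "length ((inv\<^bsub>tree_Aut\<^esub> h) v) \<le> n"
    using length_tree_Aut[of "inv\<^bsub>tree_Aut\<^esub> h"] h by simp
  then have "g ((inv\<^bsub>tree_Aut\<^esub> h) v) = v"
    using a h by (simp add: agree_upto_def tree_Aut_inv_apply)
  then show "(inv\<^bsub>tree_Aut\<^esub> g) v = (inv\<^bsub>tree_Aut\<^esub> h) v"
    using tree_Aut_inv_apply(2)[OF g] by metis
qed

lemma agree_upto_if_tree_dist_less:
  assumes "g \<in> carrier tree_Aut" "h \<in> carrier tree_Aut" "tree_dist g h < (1/2) ^ n"
  shows "agree_upto n g h"
  unfolding agree_upto_iff_portrait[OF assms(1,2)]
proof (intro allI impI)
  fix v :: "'a list" assume v: "length v < n"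
  show "portrait g v = portrait h v"
  proof (rule ccontr)
    assume "portrait g v \<noteq> portrait h v"
    from tree_dist_upper[OF this] have "(1/2) ^ length v < (1/2 :: real) ^ n"
      using assms(3) by (rule le_less_trans)
    moreover have "(1/2 :: real) ^ n \<le> (1/2) ^ length v"
      using v by (intro power_decreasing) auto
    ultimately show False by simp
  qed
qed

lemma tree_dist_le_if_agree_upto:
  assumes "g \<in> carrier tree_Aut" "h \<in> carrier tree_Aut" "agree_upto n g h"
  shows "tree_dist g h \<le> (1/2) ^ n"
proof (cases "portrait g = portrait h")
  case True
  then show ?thesis by (simp add: tree_dist_def)
next
  case False
  have "(SUP u\<in>{u. portrait g u \<noteq> portrait h u}. (1/2 :: real) ^ length u) \<le> (1/2) ^ n"
  proof (rule cSUP_least)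
    show "{u. portrait g u \<noteq> portrait h u} \<noteq> {}" using False by blast
  next
    fix u assume "u \<in> {u. portrait g u \<noteq> portrait h u}"
    then have "n \<le> length u"
      using assms(3) not_le by (auto simp: agree_upto_iff_portrait[OF assms(1,2)])
    then show "(1/2 :: real) ^ length u \<le> (1/2) ^ n" by (intro power_decreasing) auto
  qed
  then show ?thesis using False by (simp add: tree_dist_def)
qed

text \<open>Distance below \<open>(1/2) ^ n\<close> implies \<open>agree_upto n\<close>, which
  implies distance at most \<open>(1/2) ^ n\<close>. These radii tend to 0, so the closure can be
  tested level by level.\<close>

lemma closure_of_tree_topology:
  assumes S: "S \<subseteq> carrier tree_Aut"
  shows "tree_topology closure_of S = {g \<in> carrier tree_Aut. \<forall>n. \<exists>h\<in>S. agree_upto n g h}"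
proof -
  have "(\<forall>r>0. \<exists>h\<in>S. tree_dist g h < r) \<longleftrightarrow> (\<forall>n. \<exists>h\<in>S. agree_upto n g h)"
    if g: "g \<in> carrier tree_Aut" for g
  proof (intro iffI allI impI)
    fix n assume "\<forall>r>0. \<exists>h\<in>S. tree_dist g h < r"
    moreover have "(1/2 :: real) ^ n > 0" by simp
    ultimately obtain h where h: "h \<in> S" "tree_dist g h < (1/2) ^ n" by blast
    then have "agree_upto n g h"
      using S by (intro agree_upto_if_tree_dist_less g) auto
    then show "\<exists>h\<in>S. agree_upto n g h" using h(1) by blast
  next
    fix r :: real assume a: "\<forall>n. \<exists>h\<in>S. agree_upto n g h" and "0 < r"
    then obtain n where n: "(1/2) ^ n < r" using real_arch_pow_inv[of r "1/2"] by auto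
    obtain h where h: "h \<in> S" "agree_upto n g h" using a by blast
    then have "tree_dist g h \<le> (1/2) ^ n"
      using S by (intro tree_dist_le_if_agree_upto g) auto
    then have "tree_dist g h < r" using n by (rule le_less_trans)
    then show "\<exists>h\<in>S. tree_dist g h < r" using h(1) by blast
  qed
  moreover have "h \<in> S \<Longrightarrow> h \<in> carrier tree_Aut" for h using S by blast
  ultimately show ?thesis
    unfolding tree_topology_def Metric_space.metric_closure_of[OF Metric_space_tree_Aut]
      Metric_space.in_mball[OF Metric_space_tree_Aut]
    by (intro Collect_cong) (simp cong: conj_cong bex_cong)
qed

section \<open>Groups defined by patterns\<close>

text \<open>A pattern-free form of the group \<open>G\<close>: comparing sections with elements of
  \<open>K\<close> reduces closure under products and inverses to the same closure of
  \<open>K\<close>. For self-similar \<open>K\<close> it agrees with the description by allowed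
  patterns.\<close>

definition constrained :: "nat \<Rightarrow> ('x list \<Rightarrow> 'x list) set \<Rightarrow> ('x list \<Rightarrow> 'x list) set" where
  "constrained m K = {g \<in> carrier tree_Aut. \<forall>u. \<exists>k\<in>K. agree_upto m (sect g u) k}"

text \<open>By self-similarity, a pattern that appears in \<open>K\<close> appears at the root of an element of
  \<open>K\<close>.\<close>

lemma constrained_eq_allowed_patterns:
  fixes K :: "('x::finite list \<Rightarrow> 'x list) set"
  assumes K: "K \<subseteq> carrier tree_Aut" and ss: "self_similar K"
  shows "constrained m K = {g \<in> carrier tree_Aut. \<forall>p\<in>patterns m.
    (\<exists>u. contains_pattern m g p u) \<longrightarrow> (\<exists>h\<in>K. appears_in m p h)}"
proof -
  have "(\<forall>u. \<exists>k\<in>K. agree_upto m (sect g u) k) \<longleftrightarrow>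
      (\<forall>p\<in>patterns m. (\<exists>u. contains_pattern m g p u) \<longrightarrow> (\<exists>h\<in>K. appears_in m p h))"
    if g: "g \<in> carrier tree_Aut" for g
  proof (intro iffI allI ballI impI)
    fix p assume a: "\<forall>u. \<exists>k\<in>K. agree_upto m (sect g u) k" and "\<exists>u. contains_pattern m g p u"
    then obtain u where u: "contains_pattern m g p u" by blast
    obtain k where k: "k \<in> K" "agree_upto m (sect g u) k" using a by blast
    then have kc: "k \<in> carrier tree_Aut" using K by blast
    have "contains_pattern m k p []"
      using u k(2) unfolding agree_upto_iff_portrait[OF sect_tree_Aut[OF g] kc]
      by (simp add: contains_pattern_def portrait_sect[OF g])
    then show "\<exists>h\<in>K. appears_in m p h" using k(1) by (auto simp: appears_in_def)
  next
    fix u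
    assume a: "\<forall>p\<in>patterns m. (\<exists>u. contains_pattern m g p u) \<longrightarrow> (\<exists>h\<in>K. appears_in m p h)"
    define p where "p = restrict (\<lambda>v. portrait g (u @ v)) {v. length v < m}"
    have "p \<in> patterns m" using bij_portrait[OF g] by (simp add: p_def patterns_def)
    moreover have "contains_pattern m g p u" by (simp add: contains_pattern_def p_def)
    ultimately obtain h w where h: "h \<in> K" and w: "contains_pattern m h p w"
      using a by (auto simp: appears_in_def)
    have hc: "h \<in> carrier tree_Aut" using h K by blast
    have "agree_upto m (sect g u) (sect h w)"
      using w unfolding agree_upto_iff_portrait[OF sect_tree_Aut[OF g] sect_tree_Aut[OF hc]]
      by (simp add: contains_pattern_def p_def portrait_sect[OF g] portrait_sect[OF hc])
    moreover have "sect h w \<in> K" using ss h by (simp add: self_similar_def)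
    ultimately show "\<exists>k\<in>K. agree_upto m (sect g u) k" by blast
  qed
  then show ?thesis unfolding constrained_def by blast
qed

text \<open>Sections of products and inverses are products and inverses of sections, at shifted
  vertices, and \<open>agree_upto\<close> respects both operations. Hence the elements of
  \<open>K\<close> approximating the factors can be multiplied or inverted.\<close>

lemma subgroup_constrained:
  fixes K :: "('x::finite list \<Rightarrow> 'x list) set"
  assumes K: "subgroup K tree_Aut"
  shows "subgroup (constrained m K) tree_Aut"
proof (rule tree.subgroupI)
  have Kc: "K \<subseteq> carrier tree_Aut" using K by (rule subgroup.subset)
  show "constrained m K \<subseteq> carrier tree_Aut" by (auto simp: constrained_def)
  have "id \<in> K" using subgroup.one_closed[OF K] by simp
  then have "id \<in> constrained m K"
    by (auto simp: constrained_def id_tree_Aut sect_id agree_upto_def intro!: bexI[of _ id])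
  then show "constrained m K \<noteq> {}" by blast
  fix g assume g: "g \<in> constrained m K"
  then have gc: "g \<in> carrier tree_Aut" by (simp add: constrained_def)
  have "\<exists>k\<in>K. agree_upto m (sect (inv\<^bsub>tree_Aut\<^esub> g) u) k" for u
  proof -
    obtain k where k: "k \<in> K" "agree_upto m (sect g ((inv\<^bsub>tree_Aut\<^esub> g) u)) k"
      using g by (auto simp: constrained_def)
    then have "agree_upto m (sect (inv\<^bsub>tree_Aut\<^esub> g) u) (inv\<^bsub>tree_Aut\<^esub> k)"
      using Kc gc by (auto simp: sect_inv intro!: agree_upto_inv sect_tree_Aut)
    then show ?thesis using subgroup.m_inv_closed[OF K k(1)] by blast
  qed
  then show "inv\<^bsub>tree_Aut\<^esub> g \<in> constrained m K" using gc by (simp add: constrained_def)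
  fix h assume h: "h \<in> constrained m K"
  then have hc: "h \<in> carrier tree_Aut" by (simp add: constrained_def)
  have "\<exists>k\<in>K. agree_upto m (sect (g \<circ> h) u) k" for u
  proof -
    obtain k l where kl: "k \<in> K" "agree_upto m (sect g (h u)) k"
      "l \<in> K" "agree_upto m (sect h u) l"
      using g h unfolding constrained_def by blast
    then have "agree_upto m (sect (g \<circ> h) u) (k \<circ> l)"
      by (simp add: sect_comp gc hc agree_upto_comp sect_tree_Aut)
    then show ?thesis using subgroup.m_closed[OF K kl(1,3)] by auto
  qed
  then show "g \<otimes>\<^bsub>tree_Aut\<^esub> h \<in> constrained m K"
    using tree_Aut_comp[OF gc hc] by (simp add: constrained_def)
qed

lemma self_similar_constrained:
  fixes K :: "('x::finite list \<Rightarrow> 'x list) set"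
  shows "self_similar (constrained m K)"
  by (auto simp: self_similar_def constrained_def sect_tree_Aut sect_sect)

text \<open>The pattern of size \<open>m\<close> at \<open>u\<close> involves only levels below
  \<open>length u + m\<close>, so an approximation of \<open>g\<close> to that depth already has the
  same pattern there.\<close>

lemma constrained_closed:
  fixes K :: "('x::finite list \<Rightarrow> 'x list) set"
  assumes g: "g \<in> carrier tree_Aut" and lim: "\<And>n. \<exists>h\<in>constrained m K. agree_upto n g h"
  shows "g \<in> constrained m K"
proof -
  have "\<exists>k\<in>K. agree_upto m (sect g u) k" for u
  proof -
    obtain h where h: "h \<in> constrained m K" "agree_upto (length u + m) g h" using lim by blast
    then have hc: "h \<in> carrier tree_Aut" by (simp add: constrained_def)
    have "agree_upto m (sect g u) (sect h u)"
      using h(2) unfolding agree_upto_iff_portrait[OF g hc]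
        agree_upto_iff_portrait[OF sect_tree_Aut[OF g] sect_tree_Aut[OF hc]]
      by (simp add: portrait_sect[OF g] portrait_sect[OF hc])
    moreover obtain k where "k \<in> K" "agree_upto m (sect h u) k"
      using h(1) by (auto simp: constrained_def)
    ultimately show ?thesis using agree_upto_trans by blast
  qed
  then show ?thesis using g by (simp add: constrained_def)
qed

section \<open>Automorphisms with prescribed sections below some level\<close>

text \<open>The level \<open>n\<close> may depend on \<open>g\<close>. For \<open>L = {id}\<close>
  these are the finitary automorphisms.\<close>

definition ultimately_in :: "('x list \<Rightarrow> 'x list) set \<Rightarrow> ('x list \<Rightarrow> 'x list) set" where
  "ultimately_in L = {g \<in> carrier tree_Aut. \<exists>n. \<forall>u. length u = n \<longrightarrow> sect g u \<in> L}"

text \<open>Below level \<open>n\<close>, a section of \<open>g\<close> is a section of an element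
  of \<open>L\<close>. This allows elements with different levels to be compared at a common
  one.\<close>

lemma sect_in_below:
  fixes L :: "('x::finite list \<Rightarrow> 'x list) set"
  assumes L: "self_similar L" and g: "g \<in> carrier tree_Aut"
    and n: "\<forall>u. length u = n \<longrightarrow> sect g u \<in> L" and u: "n \<le> length u"
  shows "sect g u \<in> L"
proof -
  have "sect (sect g (take n u)) (drop n u) \<in> L"
    using L n u by (simp add: self_similar_def)
  then show ?thesis by (simp add: sect_sect g)
qed

lemma subgroup_ultimately_in:
  fixes L :: "('x::finite list \<Rightarrow> 'x list) set"
  assumes L: "subgroup L tree_Aut" and ss: "self_similar L"
  shows "subgroup (ultimately_in L) tree_Aut"
proof (rule tree.subgroupI)
  show "ultimately_in L \<subseteq> carrier tree_Aut" by (auto simp: ultimately_in_def)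
  have "id \<in> L" using subgroup.one_closed[OF L] by simp
  then have "id \<in> ultimately_in L" by (simp add: ultimately_in_def id_tree_Aut sect_id)
  then show "ultimately_in L \<noteq> {}" by blast
  fix g assume "g \<in> ultimately_in L"
  then obtain n where g: "g \<in> carrier tree_Aut" "\<forall>u. length u = n \<longrightarrow> sect g u \<in> L"
    by (auto simp: ultimately_in_def)
  have "sect (inv\<^bsub>tree_Aut\<^esub> g) u \<in> L" if "length u = n" for u
    using g that length_tree_Aut[of "inv\<^bsub>tree_Aut\<^esub> g"]
    by (simp add: sect_inv subgroup.m_inv_closed[OF L])
  then show "inv\<^bsub>tree_Aut\<^esub> g \<in> ultimately_in L" using g by (auto simp: ultimately_in_def)
  fix h assume "h \<in> ultimately_in L"
  then obtain m where h: "h \<in> carrier tree_Aut" "\<forall>u. length u = m \<longrightarrow> sect h u \<in> L"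
    by (auto simp: ultimately_in_def)
  \<comment> \<open>At level \<open>max m n\<close> the sections of both factors lie in
    \<open>L\<close>; the one of \<open>g\<close> is taken at \<open>h u\<close>, which has the same
    length as \<open>u\<close>.\<close>
  have "sect (g \<circ> h) u \<in> L" if "length u = max m n" for u
    using subgroup.m_closed[OF L sect_in_below[OF ss g] sect_in_below[OF ss h], of "h u" u]
      that by (simp add: sect_comp g h length_tree_Aut)
  then show "g \<otimes>\<^bsub>tree_Aut\<^esub> h \<in> ultimately_in L"
    using tree_Aut_comp[OF g(1) h(1)] by (auto simp: ultimately_in_def)
qed

lemma self_similar_ultimately_in:
  fixes L :: "('x::finite list \<Rightarrow> 'x list) set"
  assumes ss: "self_similar L"
  shows "self_similar (ultimately_in L)"
  unfolding self_similar_def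
proof (intro ballI allI)
  fix g u assume "g \<in> ultimately_in L"
  then obtain n where g: "g \<in> carrier tree_Aut" "\<forall>u. length u = n \<longrightarrow> sect g u \<in> L"
    by (auto simp: ultimately_in_def)
  have "sect (sect g u) v \<in> L" if "length v = n" for v
    using sect_in_below[OF ss g, of "u @ v"] that by (simp add: sect_sect g)
  then show "sect g u \<in> ultimately_in L"
    using sect_tree_Aut[OF g(1)] by (auto simp: ultimately_in_def)
qed

text \<open>For fixed \<open>n\<close>, an automorphism is determined by its portrait above level
  \<open>n\<close> and its sections at level \<open>n\<close>. Both are functions on finite sets of
  words, with values in a finite set and in the countable set \<open>L\<close> respectively.\<close>

lemma countable_ultimately_in:
  fixes L :: "('x::finite list \<Rightarrow> 'x list) set"
  assumes L: "countable L"
  shows "countable (ultimately_in L)"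
proof -
  define A where
    "A n = {g \<in> carrier tree_Aut. \<forall>u. length u = n \<longrightarrow> sect g u \<in> L}" for n
  define F where "F n g = (restrict (portrait g) {u. length u < n},
      restrict (sect g) {u. length u = n})" for n and g :: "'x list \<Rightarrow> 'x list"
  have "countable (A n)" for n
  proof -
    have "inj_on (F n) (A n)"
    proof (rule inj_onI)
      fix g h assume "g \<in> A n" "h \<in> A n" and eq: "F n g = F n h"
      then have g: "g \<in> carrier tree_Aut" and h: "h \<in> carrier tree_Aut" by (simp_all add: A_def)
      have top: "portrait g u = portrait h u" if "length u < n" for u
        using fun_cong[OF arg_cong[OF eq, of fst], of u] that by (simp add: F_def)
      have sec: "sect g u = sect h u" if "length u = n" for u
        using fun_cong[OF arg_cong[OF eq, of snd], of u] that by (simp add: F_def)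
      show "g = h"
      proof (rule portrait_unique[OF g h])
        fix u
        show "portrait g u = portrait h u"
        proof (cases "length u < n")
          case False
          then have "sect g (take n u) = sect h (take n u)" by (intro sec) simp
          then show ?thesis
            using portrait_sect[OF g, of "take n u" "drop n u"]
              portrait_sect[OF h, of "take n u" "drop n u"] by simp
        qed (rule top)
      qed
    qed
    moreover have "F n ` A n \<subseteq>
        ({u. length u < n} \<rightarrow>\<^sub>E UNIV) \<times> ({u. length u = n} \<rightarrow>\<^sub>E L)"
      by (auto simp: F_def A_def)
    moreover have "countable (({u :: 'x list. length u < n} \<rightarrow>\<^sub>E (UNIV :: ('x \<Rightarrow> 'x) set))
        \<times> ({u :: 'x list. length u = n} \<rightarrow>\<^sub>E L))"
      using L by (intro countable_SIGMA countable_PiE finite_words_shorter finite_words_of_length)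
        (simp_all add: countable_finite)
    ultimately show ?thesis
      using countable_image_inj_on[OF countable_subset] by blast
  qed
  moreover have "ultimately_in L = (\<Union>n. A n)" by (auto simp: ultimately_in_def A_def)
  ultimately show ?thesis by simp
qed

text \<open>The same finite set \<open>N\<close> works: an element has only finitely many sections
  at level \<open>n\<close>, each in \<open>L\<close>, so the maximum \<open>M\<close> of the depths
  they need gives the uniform depth \<open>n + M\<close>.\<close>

lemma contracting_ultimately_in:
  fixes L :: "('x::finite list \<Rightarrow> 'x list) set"
  assumes "contracting L"
  shows "contracting (ultimately_in L)"
proof -
  obtain N where N: "finite N" "N \<subseteq> carrier tree_Aut"
    and nuc: "\<forall>g\<in>L. \<exists>n. \<forall>m\<ge>n. \<forall>u. length u = m \<longrightarrow> sect g u \<in> N"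
    using assms unfolding contracting_def by blast
  obtain d where "\<forall>g\<in>L. \<forall>m\<ge>d g. \<forall>u. length u = m \<longrightarrow> sect g u \<in> N"
    using bchoice[OF nuc] ..
  then have d: "sect g u \<in> N" if "g \<in> L" "d g \<le> length u" for g u
    using that by simp
  have "\<exists>n. \<forall>m\<ge>n. \<forall>u. length u = m \<longrightarrow> sect g u \<in> N" if gu: "g \<in> ultimately_in L" for g
  proof -
    obtain n where g: "g \<in> carrier tree_Aut" and n: "\<forall>u. length u = n \<longrightarrow> sect g u \<in> L"
      using gu unfolding ultimately_in_def by blast
    define M where "M = Max ((\<lambda>u. d (sect g u)) ` {u. length u = n})"
    have M: "d (sect g u) \<le> M" if "length u = n" for u
      unfolding M_def using that by (intro Max_ge) (simp_all add: finite_words_of_length)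
    have "sect g u \<in> N" if "n + M \<le> length u" for u
    proof -
      have l: "length (take n u) = n" using that by simp
      have "sect (sect g (take n u)) (drop n u) \<in> N"
      proof (rule d)
        show "sect g (take n u) \<in> L" using n l by blast
        show "d (sect g (take n u)) \<le> length (drop n u)" using M[OF l] that by simp
      qed
      then show ?thesis by (simp add: sect_sect g)
    qed
    then show ?thesis by (intro exI[of _ "n + M"]) simp
  qed
  then have "\<forall>g\<in>ultimately_in L. \<exists>n. \<forall>m\<ge>n. \<forall>u. length u = m \<longrightarrow> sect g u \<in> N" ..
  with N show ?thesis unfolding contracting_def by (intro exI[of _ N] conjI)
qed

lemma contracting_subset: "contracting K \<Longrightarrow> L \<subseteq> K \<Longrightarrow> contracting L"
  unfolding contracting_def by (metis (no_types, lifting) subsetD)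

section \<open>Branching and density of the intersection of the two groups\<close>

text \<open>If every \<open>h x\<close> fixes level \<open>s\<close>, then
  \<open>level_one h\<close> fixes level \<open>s + 1\<close>, so its root pattern of size
  \<open>s + 1\<close> is that of \<open>id\<close>. Any other vertex lies in the subtree of some
  letter \<open>x\<close>, where the patterns are those of \<open>h x\<close>.\<close>

lemma regular_branch_constrained_ultimately_in:
  fixes K L :: "('x::finite list \<Rightarrow> 'x list) set"
  assumes K: "id \<in> K" and L: "self_similar L"
  shows "regular_branch_over_level (constrained (s + 1) K \<inter> ultimately_in L) s"
  unfolding regular_branch_over_level_def
proof (intro allI impI)
  fix h :: "'x \<Rightarrow> 'x list \<Rightarrow> 'x list"
  assume h: "\<forall>x. h x \<in> level_stabilizer (constrained (s + 1) K \<inter> ultimately_in L) s"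
  then have con: "h x \<in> constrained (s + 1) K" and ult: "h x \<in> ultimately_in L" for x
    by (simp_all add: level_stabilizer_def)
  have hc: "h x \<in> carrier tree_Aut" for x using con by (simp add: constrained_def)
  have fix_h: "h x u = u" if "length u \<le> s" for x u
  proof -
    \<comment> \<open>The stabilizer condition concerns words of length exactly \<open>s\<close>, so
      \<open>u\<close> is padded to that length. The letter used is arbitrary.\<close>
    let ?r = "replicate (s - length u) undefined"
    have "h x (u @ ?r) = u @ ?r" using h that by (simp add: level_stabilizer_def)
    then have "h x u @ sect (h x) u ?r = u @ ?r" unfolding tree_Aut_append[OF hc] .
    then show ?thesis using length_tree_Aut[OF hc, of x u] by simp
  qed
  define g where "g = level_one h"
  have g: "g \<in> carrier tree_Aut" and sg: "sect g [x] = h x" and g1: "g [x] = [x]" for x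
    using level_one[of h] hc by (simp_all add: g_def)
  have g_Cons: "g (x # u) = x # h x u" for x u
    using tree_Aut_append[OF g, of "[x]" u] by (simp add: sg g1)
  have sg_Cons: "sect g (x # u) = sect (h x) u" for x u
    using sect_sect[OF g, of "[x]" u] by (simp add: sg)
  have fix_g: "g u = u" if "length u \<le> s + 1" for u
  proof (cases u)
    case Nil
    then show ?thesis using g by (simp add: tree_Aut_iff)
  next
    case (Cons x v)
    then show ?thesis using that by (simp add: g_Cons fix_h)
  qed
  have "\<exists>k\<in>K. agree_upto (s + 1) (sect g u) k" for u
  proof (cases u)
    case Nil
    have "agree_upto (s + 1) (sect g u) id"
      using fix_g by (simp add: Nil sect_Nil g agree_upto_def)
    then show ?thesis using K by blast
  next
    case (Cons x v)
    then show ?thesis using con[of x] by (simp add: sg_Cons constrained_def)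
  qed
  then have "g \<in> constrained (s + 1) K" using g by (simp add: constrained_def)
  moreover have "g \<in> ultimately_in L"
  proof -
    have "\<forall>x. \<exists>n. \<forall>u. length u = n \<longrightarrow> sect (h x) u \<in> L"
      using ult unfolding ultimately_in_def by blast
    from choice[OF this] obtain n
      where n: "\<And>x. \<forall>u. length u = n x \<longrightarrow> sect (h x) u \<in> L" by blast
    \<comment> \<open>One letter selects the subtree \<open>x\<close>; the remaining
      \<open>Max (range n)\<close> letters suffice for every \<open>h x\<close>, the alphabet being
      finite.\<close>
    have "sect g u \<in> L" if u: "length u = Suc (Max (range n))" for u
    proof -
      obtain x v where xv: "u = x # v" using u by (cases u) auto
      have "n x \<le> length v" using u xv by simp
      then have "sect (h x) v \<in> L" by (rule sect_in_below[OF L hc n])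
      then show ?thesis by (simp add: xv sg_Cons)
    qed
    then show ?thesis using g unfolding ultimately_in_def by blast
  qed
  ultimately show "level_one h \<in> level_stabilizer (constrained (s + 1) K \<inter> ultimately_in L) s"
    using fix_g by (simp add: level_stabilizer_def flip: g_def)
qed

lemma constrained_ultimately_in_dense:
  fixes K L :: "('x::finite list \<Rightarrow> 'x list) set"
  assumes K: "K \<subseteq> carrier tree_Aut" and LK: "L \<subseteq> K" and L: "self_similar L"
    and same: "\<And>k. k \<in> K \<Longrightarrow> \<exists>l\<in>L. agree_upto m k l" and g: "g \<in> constrained m K"
  shows "\<exists>h \<in> constrained m K \<inter> ultimately_in L. agree_upto n g h"
proof -
  have gc: "g \<in> carrier tree_Aut" using g by (simp add: constrained_def)
  have "\<exists>l. l \<in> L \<and> agree_upto m (sect g u) l" for u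
  proof -
    obtain k where k: "k \<in> K" "agree_upto m (sect g u) k"
      using g unfolding constrained_def by blast
    \<comment> \<open>Membership of \<open>g\<close> in the constrained group only supplies an
      element of \<open>K\<close>; \<open>same\<close> trades it for one of \<open>L\<close> with
      the same root pattern.\<close>
    obtain l where "l \<in> L" "agree_upto m k l" using same k(1) by blast
    then show ?thesis using agree_upto_trans k(2) by blast
  qed
  then obtain l where l: "\<And>u. l u \<in> L" "\<And>u. agree_upto m (sect g u) (l u)"
    using choice[of "\<lambda>u l. l \<in> L \<and> agree_upto m (sect g u) l"] by blast
  have lc: "l u \<in> carrier tree_Aut" for u using l(1) K LK by blast
  define p where
    "p v = (if length v < n then portrait g v else portrait (l (take n v)) (drop n v))" for v
  define h where "h = (\<lambda>u. of_portrait u p)"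
  have "bij (p v)" for v using bij_portrait[OF gc] bij_portrait[OF lc] by (simp add: p_def)
  then have h: "h \<in> carrier tree_Aut" unfolding h_def by (rule of_portrait_tree_Aut)
  have ph: "portrait h = p" by (simp add: h_def portrait_of_portrait)
  have sect_h: "sect h u = l u" if "length u = n" for u
    by (rule sect_eqI[OF h lc]) (use that in \<open>simp add: ph p_def\<close>)
  \<comment> \<open>The agreement reaches \<open>m\<close> levels further than the portrait copied
    from \<open>g\<close>, since \<open>l u\<close> starts with the pattern of \<open>g\<close> at
    \<open>u\<close>. So patterns of \<open>h\<close> straddling level \<open>n\<close> are still
    patterns of \<open>g\<close>.\<close>
  have top: "portrait g v = portrait h v" if v: "length v < n + m" for v
  proof (cases "length v < n")
    case False
    have "portrait (sect g (take n v)) (drop n v) = portrait (l (take n v)) (drop n v)"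
      using l(2)[of "take n v"] v False by (simp add: agree_upto_iff_portrait sect_tree_Aut gc lc)
    then show ?thesis using False by (simp add: ph p_def portrait_sect[OF gc])
  qed (simp add: ph p_def)
  have ult: "\<forall>u. length u = n \<longrightarrow> sect h u \<in> L" using sect_h l(1) by simp
  have "\<exists>k\<in>K. agree_upto m (sect h u) k" for u
  proof (cases "length u \<le> n")
    case True
    then have "agree_upto m (sect h u) (sect g u)"
      using top by (simp add: agree_upto_iff_portrait sect_tree_Aut gc h portrait_sect)
    moreover obtain k where "k \<in> K" "agree_upto m (sect g u) k"
      using g by (auto simp: constrained_def)
    ultimately show ?thesis using agree_upto_trans by blast
  next
    case False
    then have "sect h u \<in> K" using sect_in_below[OF L h ult, of u] LK by auto
    then show ?thesis by (auto simp: agree_upto_def)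
  qed
  moreover have "agree_upto n g h" using top by (simp add: agree_upto_iff_portrait gc h)
  ultimately show ?thesis using h ult by (auto simp: constrained_def ultimately_in_def)
qed

section \<open>A countable self-similar subgroup with the same patterns\<close>

text \<open>Every generated element is the product of a finite list of generators and inverses of
  generators, and there are countably many such lists.\<close>

lemma (in group) countable_generate:
  assumes S: "countable S" "S \<subseteq> carrier G"
  shows "countable (generate G S)"
proof -
  define T where "T = S \<union> m_inv G ` S"
  define prd where "prd xs = foldr (\<otimes>) xs \<one>" for xs
  have Tc: "T \<subseteq> carrier G" using S by (auto simp: T_def)
  have prd_closed: "prd xs \<in> carrier G" if "set xs \<subseteq> carrier G" for xs
    using that by (induction xs) (auto simp: prd_def)
  have prd_append: "prd (xs @ ys) = prd xs \<otimes> prd ys"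
    if "set xs \<subseteq> carrier G" "set ys \<subseteq> carrier G" for xs ys
    using that prd_closed by (induction xs) (auto simp: prd_def m_assoc)
  have single: "t \<in> prd ` lists T" if "t \<in> T" for t
    using that Tc by (intro image_eqI[of _ _ "[t]"]) (auto simp: prd_def)
  have "generate G S \<subseteq> prd ` lists T"
  proof
    fix g assume "g \<in> generate G S"
    then show "g \<in> prd ` lists T"
    proof induction
      case one
      show ?case by (rule image_eqI[of _ _ "[]"]) (simp_all add: prd_def)
    next
      case (eng g h)
      then obtain xs ys where "xs \<in> lists T" "ys \<in> lists T" "g = prd xs" "h = prd ys" by auto
      moreover from this have "g \<otimes> h = prd (xs @ ys)"
        using Tc by (subst prd_append) (auto simp: in_lists_conv_set)
      ultimately show ?case by (intro image_eqI[of _ _ "xs @ ys"]) auto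
    next
      case (incl g)
      then show ?case by (intro single) (simp add: T_def)
    next
      case (inv g)
      then show ?case by (intro single) (simp add: T_def)
    qed
  qed
  moreover have "countable (prd ` lists T)" using S(1) by (simp add: T_def)
  ultimately show ?thesis by (rule countable_subset)
qed

text \<open>The induction has to treat all vertices at once, because the section of a product at
  \<open>u\<close> involves the section of \<open>g\<close> at \<open>h u\<close>.\<close>

lemma self_similar_generate:
  fixes S :: "('x::finite list \<Rightarrow> 'x list) set"
  assumes Sc: "S \<subseteq> carrier tree_Aut" and S: "self_similar S"
  shows "self_similar (generate tree_Aut S)"
proof -
  have "\<forall>u. sect g u \<in> generate tree_Aut S" if "g \<in> generate tree_Aut S" for g
    using that
  proof induction
    case one
    show ?case using generate.one[of tree_Aut S] unfolding tree_Aut_one sect_id by blast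
  next
    case (incl g)
    then show ?case using S by (simp add: self_similar_def generate.incl)
  next
    case (inv g)
    have "sect g u \<in> S" for u using S inv by (simp add: self_similar_def)
    moreover have "g \<in> carrier tree_Aut" using inv Sc by blast
    ultimately show ?case by (simp add: sect_inv generate.inv)
  next
    case (eng g h)
    have "g \<in> carrier tree_Aut" "h \<in> carrier tree_Aut"
      using eng.hyps tree.generate_in_carrier[OF Sc] by blast+
    moreover have "sect g (h u) \<circ> sect h u \<in> generate tree_Aut S" for u
      using generate.eng[OF eng.IH(1)[rule_format] eng.IH(2)[rule_format]] by simp
    ultimately show ?case unfolding tree_Aut_mult by (simp only: sect_comp simp_thms)
  qed
  then show ?thesis by (simp add: self_similar_def)
qed

text \<open>Over a finite alphabet there are finitely many patterns of size \<open>m\<close>, so a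
  finite \<open>S\<close> realises those of \<open>K\<close>. Its sections form a countable set
  \<open>T\<close>, inside \<open>K\<close> by self-similarity, and \<open>L\<close> is the group
  generated by \<open>T\<close>.\<close>

lemma countable_self_similar_subgroup:
  fixes K :: "('x::finite list \<Rightarrow> 'x list) set"
  assumes K: "subgroup K tree_Aut" "self_similar K"
  obtains L where "subgroup L tree_Aut" "self_similar L" "countable L" "L \<subseteq> K"
    "\<And>k. k \<in> K \<Longrightarrow> \<exists>l\<in>L. agree_upto m k l"
proof -
  define F where "F k = restrict (portrait k) {v. length v < m}" for k :: "'x list \<Rightarrow> 'x list"
  have Kc: "K \<subseteq> carrier tree_Aut" using K(1) by (rule subgroup.subset)
  have "F ` K \<subseteq> {v. length v < m} \<rightarrow>\<^sub>E UNIV" by (auto simp: F_def)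
  then have "finite (F ` K)"
    by (rule finite_subset) (intro finite_PiE finite_words_shorter finite)
  \<comment> \<open>\<open>F k\<close> is the root pattern of \<open>k\<close>, so \<open>S\<close>
    contains a representative for each root pattern occurring in \<open>K\<close>.\<close>
  then obtain S where S: "S \<subseteq> K" "finite S" "F ` K = F ` S"
    using finite_subset_image[of "F ` K" F K] by auto
  define T where "T = (\<lambda>(k, u). sect k u) ` (S \<times> UNIV)"
  have Sc: "S \<subseteq> carrier tree_Aut" using S(1) Kc by blast
  have TK: "T \<subseteq> K" using S(1) K(2) by (auto simp: T_def self_similar_def)
  then have Tc: "T \<subseteq> carrier tree_Aut" using Kc by blast
  have "sect (sect k u) v \<in> T" if "k \<in> S" for k u v
  proof -
    have "k \<in> carrier tree_Aut" using that Sc by blast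
    then show ?thesis
      using that unfolding T_def by (intro image_eqI[of _ _ "(k, u @ v)"]) (simp_all add: sect_sect)
  qed
  then have Tss: "self_similar T" by (auto simp: T_def self_similar_def)
  have "countable T" using S(2) by (simp add: T_def countable_finite)
  then have "countable (generate tree_Aut T)" using Tc by (rule tree.countable_generate)
  moreover have "\<exists>l\<in>generate tree_Aut T. agree_upto m k l" if k: "k \<in> K" for k
  proof -
    obtain l where l: "l \<in> S" "F k = F l" using S(3) k by blast
    have lc: "l \<in> carrier tree_Aut" using l(1) Sc by blast
    have "portrait k v = portrait l v" if "length v < m" for v
      using fun_cong[OF l(2), of v] that by (simp add: F_def)
    then have "agree_upto m k l" using k Kc lc by (subst agree_upto_iff_portrait) auto
    moreover have "l \<in> T"
      unfolding T_def using l(1) sect_Nil[OF lc]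
      by (intro image_eqI[of _ _ "(l, [])"]) simp_all
    ultimately show ?thesis using generate.incl[of l T tree_Aut] by blast
  qed
  ultimately show thesis
    using tree.generate_is_subgroup[OF Tc] self_similar_generate[OF Tc Tss]
      tree.generate_subgroup_incl[OF TK K(1)] that by blast
qed

theorem theorem1:
  fixes K G :: "('x::finite list \<Rightarrow> 'x list) set" and s :: nat
  assumes "subgroup K tree_Aut" and "self_similar K"
    and "G = {g \<in> carrier tree_Aut. \<forall>p\<in>patterns (s + 1).
              (\<exists>u. contains_pattern (s + 1) g p u) \<longrightarrow> (\<exists>h\<in>K. appears_in (s + 1) p h)}"
  shows "\<exists>H. subgroup H tree_Aut \<and> self_similar H \<and> countable H \<and>
             regular_branch_over_level H s \<and> tree_topology closure_of H = G \<and>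
             (contracting K \<longrightarrow> contracting H)"
proof -
  have Kc: "K \<subseteq> carrier tree_Aut" using assms(1) by (rule subgroup.subset)
  have G: "G = constrained (s + 1) K"
    using constrained_eq_allowed_patterns[OF Kc assms(2)] assms(3) by simp
  obtain L where L: "subgroup L tree_Aut" "self_similar L" "countable L" "L \<subseteq> K"
    and same: "\<And>k. k \<in> K \<Longrightarrow> \<exists>l\<in>L. agree_upto (s + 1) k l"
    using countable_self_similar_subgroup[OF assms(1,2)] by metis
  \<comment> \<open>The first factor keeps \<open>H\<close> inside the closed group
    \<open>G\<close>; the second makes it countable, and contracting when \<open>K\<close>
    is.\<close>
  define H where "H = constrained (s + 1) K \<inter> ultimately_in L"
  have "subgroup H tree_Aut"
    unfolding H_def
    by (intro tree.subgroups_Inter_pair subgroup_constrained subgroup_ultimately_in assms L)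
  moreover have "self_similar H"
    using self_similar_constrained[of "s + 1" K] self_similar_ultimately_in[OF L(2)]
    unfolding H_def self_similar_def by blast
  moreover have "countable H"
    using countable_ultimately_in[OF L(3)] by (auto simp: H_def)
  moreover have "regular_branch_over_level H s"
    unfolding H_def using subgroup.one_closed[OF assms(1)] L(2)
    by (intro regular_branch_constrained_ultimately_in) simp_all
  moreover have "tree_topology closure_of H = G"
  proof -
    have Hc: "H \<subseteq> carrier tree_Aut" by (auto simp: H_def constrained_def)
    show ?thesis
      unfolding closure_of_tree_topology[OF Hc] G
    proof (intro equalityI subsetI)
      fix g assume "g \<in> {g \<in> carrier tree_Aut. \<forall>n. \<exists>h\<in>H. agree_upto n g h}"
      then show "g \<in> constrained (s + 1) K" by (intro constrained_closed) (auto simp: H_def)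
    next
      fix g assume g: "g \<in> constrained (s + 1) K"
      then have "\<exists>h\<in>H. agree_upto n g h" for n
        unfolding H_def by (intro constrained_ultimately_in_dense[OF Kc L(4,2) same])
      then show "g \<in> {g \<in> carrier tree_Aut. \<forall>n. \<exists>h\<in>H. agree_upto n g h}"
        using g by (simp add: constrained_def)
    qed
  qed
  moreover have "contracting H" if "contracting K"
  proof -
    have "contracting (ultimately_in L)"
      using contracting_ultimately_in contracting_subset[OF that L(4)] by blast
    then show ?thesis by (rule contracting_subset) (simp add: H_def)
  qed
  ultimately show ?thesis by blast
qed

end
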